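(* If $m\ge 2$ and $n\ge 2m-2$, then $\underline{{\rm gp}}_{\rm S}(K_m,K_n)=m(n-m+1)$.
   Context: $K_m$ is the complete graph on $m$ vertices. A set $X$ of vertices of a connected graph is a general position set if no shortest path contains more than two vertices of $X$; ${\rm gp}$ denotes the maximum cardinality of a general position set. For graphs $G,H$ and $f\colon V(G)\to V(H)$, the Sierpiński product $G\otimes_f H$ has vertex set $V(G)\times V(H)$ and edges $(g,h)(g,h')$ for $g\in V(G)$, $hh'\in E(H)$, and $(g,f(g'))(g',f(g))$ for $gg'\in E(G)$. $\underline{{\rm gp}}_{\rm S}(G,H)=\min_f{\rm gp}(G\otimes_f H)$ over all functions $f\colon V(G)\to V(H)$. *)

theory Defs
  imports
    "HOL-Library.FuncSet"
    "Graph_Theory.Vertex_Walk"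
    "Graph_Theory.Pair_Digraph"
    "Graph_Theory.Kuratowski"
begin

text \<open>
  Finite simple graphs are represented as symmetric loop-free digraphs, i.e. an undirected edge
  is the pair of its two orientations (locales \<^locale>\<open>graph\<close> and \<^locale>\<open>pair_graph\<close>).
\<close>

definition shortest_path :: "'a vwalk \<Rightarrow> ('a, 'b) pre_digraph \<Rightarrow> bool" where
  "shortest_path p G \<longleftrightarrow> vpath p G \<and>
     (\<forall>q. vpath q G \<and> hd q = hd p \<and> last q = last p \<longrightarrow> vwalk_length p \<le> vwalk_length q)"

definition general_position_set :: "('a, 'b) pre_digraph \<Rightarrow> 'a set \<Rightarrow> bool" where
  "general_position_set G X \<longleftrightarrow>
     X \<subseteq> verts G \<and> (\<forall>p. shortest_path p G \<longrightarrow> card (set p \<inter> X) \<le> 2)"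

text \<open>Only meaningful for graphs with finitely many vertices.\<close>

definition gp_number :: "('a, 'b) pre_digraph \<Rightarrow> nat" where
  "gp_number G = Max {card X | X. general_position_set G X}"

definition sierpinski_product ::
  "'a pair_pre_digraph \<Rightarrow> 'b pair_pre_digraph \<Rightarrow> ('a \<Rightarrow> 'b) \<Rightarrow> ('a \<times> 'b) pair_pre_digraph" where
  "sierpinski_product G H f =
     \<lparr> pverts = pverts G \<times> pverts H,
       parcs = {((g, h), (g, h')) | g h h'. g \<in> pverts G \<and> (h, h') \<in> parcs H}
             \<union> {((g, f g'), (g', f g)) | g g'. (g, g') \<in> parcs G} \<rparr>"

text \<open>
  The functions from the vertices of \<open>G\<close> to the vertices of \<open>H\<close> are taken to be extensional, so that
  they form a finite set; the product does not depend on values outside the vertices of \<open>G\<close>.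
\<close>

definition lower_sierpinski_gp :: "'a pair_pre_digraph \<Rightarrow> 'b pair_pre_digraph \<Rightarrow> nat" where
  "lower_sierpinski_gp G H =
     Min {gp_number (with_proj (sierpinski_product G H f)) | f. f \<in> pverts G \<rightarrow>\<^sub>E pverts H}"

lemma pair_graph_sierpinski_product:
  assumes "pair_graph G" "pair_graph H" "f \<in> pverts G \<rightarrow> pverts H"
  shows "pair_graph (sierpinski_product G H f)"
proof -
  interpret G: pair_graph G by fact
  interpret H: pair_graph H by fact
  let ?P = "sierpinski_product G H f"
  have sub: "parcs ?P \<subseteq> pverts ?P \<times> pverts ?P"
    using assms(3) by (auto simp: sierpinski_product_def dest: G.wellformed' H.wellformed')
  have fin: "finite (pverts ?P)"
    by (simp add: sierpinski_product_def G.pair_finite_verts H.pair_finite_verts)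
  have "sym (parcs G)" "sym (parcs H)"
    using G.pair_sym_arcs H.pair_sym_arcs by (auto simp: symmetric_def)
  then have "symmetric (with_proj ?P)"
    by (auto simp: symmetric_def sierpinski_product_def sym_def)
  moreover have "fst e \<noteq> snd e" if "e \<in> parcs ?P" for e
    using that G.pair_no_loops H.pair_no_loops by (fastforce simp: sierpinski_product_def)
  ultimately show ?thesis
    using sub fin finite_subset[OF sub] by unfold_locales auto
qed

lemma strongly_connected_sierpinski_product_complete:
  assumes G: "complete_digraph m (with_proj G)" and H: "complete_digraph n (with_proj H)"
    and "0 < m" "0 < n" and f: "f \<in> pverts G \<rightarrow> pverts H"
  shows "strongly_connected (with_proj (sierpinski_product G H f))"
proof -
  let ?P = "sierpinski_product G H f"
  have pg: "pair_graph ?P"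
    using assms by (intro pair_graph_sierpinski_product pair_graphI_complete)
  then interpret P: pair_graph ?P .
  have vP: "pverts ?P = pverts G \<times> pverts H"
    by (simp add: sierpinski_product_def)
  have step: "(g, h) \<rightarrow>\<^sup>*\<^bsub>with_proj ?P\<^esub> (g, h')"
    if "g \<in> pverts G" "h \<in> pverts H" "h' \<in> pverts H" for g h h'
  proof (cases "h = h'")
    case True
    then show ?thesis using that by (simp add: vP)
  next
    case False
    then have "((g, h), (g, h')) \<in> parcs ?P"
      using that H by (auto simp: sierpinski_product_def complete_digraph_pair_def)
    then show ?thesis by (simp add: P.reachable_adjI)
  qed
  have "(g, h) \<rightarrow>\<^sup>*\<^bsub>with_proj ?P\<^esub> (g', h')"
    if v: "g \<in> pverts G" "h \<in> pverts H" "g' \<in> pverts G" "h' \<in> pverts H" for g h g' h'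
  proof (cases "g = g'")
    case True
    then show ?thesis using step v by simp
  next
    case False
    then have "((g, f g'), (g', f g)) \<in> parcs ?P"
      using v G by (auto simp: sierpinski_product_def complete_digraph_pair_def)
    then have "(g, f g') \<rightarrow>\<^sup>*\<^bsub>with_proj ?P\<^esub> (g', f g)" by (simp add: P.reachable_adjI)
    moreover have "(g, h) \<rightarrow>\<^sup>*\<^bsub>with_proj ?P\<^esub> (g, f g')" "(g', f g) \<rightarrow>\<^sup>*\<^bsub>with_proj ?P\<^esub> (g', h')"
      using step v f by auto
    ultimately show ?thesis by (meson P.reachable_trans)
  qed
  moreover have "pverts ?P \<noteq> {}"
    using assms by (auto simp: vP complete_digraph_pair_def)
  ultimately show ?thesis by (auto simp: strongly_connected_def vP)
qed

end

theory Submission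
  imports Defs
begin

text \<open>
  A vertex \<open>(g, h)\<close> with \<open>h\<close> outside \<open>f ` (V(G) - {g})\<close> only has neighbours in its own clique, hence
  is simplicial and never an inner vertex of a shortest path. These vertices form a general position
  set with at least \<open>m (n - m + 1)\<close> elements, whatever \<open>f\<close> is.

  If \<open>f\<close> is injective, the path from \<open>(g, x)\<close> through the edge joining the copies of \<open>g\<close> and \<open>g'\<close> is
  shortest for every \<open>x \<noteq> f g'\<close>. So if a general position set has at least two vertices in the copy of
  \<open>g\<close>, one of which is \<open>(g, f g')\<close>, it misses the copy of \<open>g'\<close>. With \<open>k\<close> empty copies, every other copy
  thus has at most \<open>n - m + 1 + k\<close> vertices of the set, and \<open>(m - k) (n - m + 1 + k) \<le> m (n - m + 1)\<close>
  because \<open>m - 1 \<le> n - m + 1\<close>.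
\<close>

section \<open>Shortest paths and general position sets\<close>

text \<open>Deleting \<open>y\<close> would leave a strictly shorter path with the same
  endpoints.\<close>

lemma shortest_path_no_chord:
  assumes "shortest_path (xs @ a # y # b # ys) G"
  shows "(a, b) \<notin> arcs_ends G"
proof
  assume ab: "(a, b) \<in> arcs_ends G"
  let ?p = "xs @ a # y # b # ys" and ?q = "xs @ a # b # ys"
  have p: "vpath ?p G"
    using assms by (simp add: shortest_path_def)
  have "set (vwalk_arcs ?q) \<subseteq> insert (a, b) (set (vwalk_arcs ?p))"
    by (cases "xs = []") (auto simp: vwalk_arcs_append)
  with p ab have "vpath ?q G"
    by (auto simp: vpath_def vwalk_def)
  moreover have "hd ?q = hd ?p" "last ?q = last ?p"
    by (auto simp: hd_append)
  ultimately have "vwalk_length ?p \<le> vwalk_length ?q"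
    using assms unfolding shortest_path_def by blast
  then show False by simp
qed

lemma split_list_inner:
  assumes "y \<in> set p" "y \<noteq> hd p" "y \<noteq> last p"
  obtains xs a b ys where "p = xs @ a # y # b # ys"
proof -
  obtain us vs where p: "p = us @ y # vs"
    using assms(1) by (meson split_list)
  with assms have "us \<noteq> []" "vs \<noteq> []"
    by auto
  then obtain xs a b ys where "us = xs @ [a]" "vs = b # ys"
    by (meson neq_Nil_conv rev_exhaust)
  with p that show ?thesis by simp
qed

text \<open>An inner vertex of a shortest path has two distinct neighbours on it, and simpliciality
  would make them a chord. So only the two ends of the path can lie in \<open>X\<close>.\<close>

lemma general_position_set_simplicial:
  assumes "X \<subseteq> verts G"
    and simplicial: "\<And>a y b. \<lbrakk>y \<in> X; (a, y) \<in> arcs_ends G; (y, b) \<in> arcs_ends G; a \<noteq> b\<rbrakk>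
      \<Longrightarrow> (a, b) \<in> arcs_ends G"
  shows "general_position_set G X"
  unfolding general_position_set_def
proof (intro conjI allI impI)
  fix p assume p: "shortest_path p G"
  have "set p \<inter> X \<subseteq> {hd p, last p}"
  proof (rule ccontr)
    assume "\<not> set p \<inter> X \<subseteq> {hd p, last p}"
    then obtain y where y: "y \<in> set p" "y \<in> X" "y \<noteq> hd p" "y \<noteq> last p"
      by blast
    then obtain xs a b ys where eq: "p = xs @ a # y # b # ys"
      by (meson split_list_inner)
    have "(a, y) \<in> arcs_ends G" "(y, b) \<in> arcs_ends G" "a \<noteq> b"
      using p unfolding eq
      by (cases "xs = []"; auto simp: shortest_path_def vpath_def vwalk_def vwalk_arcs_append)+
    with y simplicial have "(a, b) \<in> arcs_ends G"
      by blast
    with p eq shortest_path_no_chord show False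
      by metis
  qed
  then have "card (set p \<inter> X) \<le> card {hd p, last p}"
    by (intro card_mono) auto
  also have "\<dots> \<le> 2"
    by (simp add: card_insert_if)
  finally show "card (set p \<inter> X) \<le> 2" .
qed fact

lemma general_position_setD:
  assumes "general_position_set G X" "shortest_path p G" "A \<subseteq> set p \<inter> X"
  shows "card A \<le> 2"
proof -
  have "card A \<le> card (set p \<inter> X)"
    using assms(3) by (intro card_mono) auto
  with assms show ?thesis
    by (force simp: general_position_set_def)
qed

lemma finite_general_position_cards:
  assumes "finite (verts G)"
  shows "finite {card X | X. general_position_set G X}"
proof (rule finite_subset)
  show "{card X | X. general_position_set G X} \<subseteq> card ` Pow (verts G)"
    by (auto simp: general_position_set_def)
qed (use assms in simp)

lemma card_le_gp_number:
  assumes "finite (verts G)" "general_position_set G X"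
  shows "card X \<le> gp_number G"
  unfolding gp_number_def
  by (rule Max_ge) (use assms finite_general_position_cards in auto)

lemma gp_number_le:
  assumes "finite (verts G)" "\<And>X. general_position_set G X \<Longrightarrow> card X \<le> c"
  shows "gp_number G \<le> c"
proof -
  \<comment> \<open>This makes the set under \<open>Max\<close> nonempty.\<close>
  have "general_position_set G {}"
    by (simp add: general_position_set_def)
  then show ?thesis
    unfolding gp_number_def using assms finite_general_position_cards[OF assms(1)]
    by (subst Max_le_iff) auto
qed

section \<open>Sierpinski products of complete graphs\<close>

text \<open>\<open>f\<close> is arbitrary here because the lower bound concerns every
  \<open>f\<close>; the upper bound adds injectivity.\<close>

locale complete_sierpinski =
  fixes G :: "'a pair_pre_digraph" and H :: "'b pair_pre_digraph" and m n :: nat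
    and f :: "'a \<Rightarrow> 'b"
  assumes G: "complete_digraph m (with_proj G)" and H: "complete_digraph n (with_proj H)"
    and f: "f \<in> pverts G \<rightarrow> pverts H"
begin

abbreviation "P \<equiv> sierpinski_product G H f"

lemma finite_G: "finite (pverts G)" and card_G: "card (pverts G) = m"
  and finite_H: "finite (pverts H)" and card_H: "card (pverts H) = n"
  using G H by (auto simp: complete_digraph_pair_def)

lemma verts_P: "pverts P = pverts G \<times> pverts H"
  by (simp add: sierpinski_product_def)

lemma finite_verts_P: "finite (verts P)"
  by (simp add: verts_P finite_G finite_H)

lemma arc_P_iff:
  "((g, h), (g', h')) \<in> parcs P \<longleftrightarrow> g \<in> pverts G \<and> g' \<in> pverts G \<and>
    (if g = g' then h \<in> pverts H \<and> h' \<in> pverts H \<and> h \<noteq> h' else h = f g' \<and> h' = f g)"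
  using G H by (auto simp: sierpinski_product_def complete_digraph_pair_def)

lemma gp_number_ge:
  assumes "m \<le> n"
  shows "m * (n - m + 1) \<le> gp_number P"
proof -
  let ?X = "SIGMA g : pverts G. pverts H - f ` (pverts G - {g})"
  have "general_position_set P ?X"
  proof (rule general_position_set_simplicial)
    show "?X \<subseteq> verts P"
      by (auto simp: verts_P)
  next
    fix a y b
    assume *: "y \<in> ?X" "(a, y) \<in> arcs_ends P" "(y, b) \<in> arcs_ends P" "a \<noteq> b"
    obtain g h where y: "y = (g, h)" by fastforce
    obtain g1 h1 where a: "a = (g1, h1)" by fastforce
    obtain g2 h2 where b: "b = (g2, h2)" by fastforce
    show "(a, b) \<in> arcs_ends P"
      \<comment> \<open>Both neighbours of \<open>y\<close> lie in its own copy, which is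
        complete.\<close>
      using * unfolding y a b by (auto simp: arc_P_iff split: if_splits)
  qed
  then have "card ?X \<le> gp_number P"
    by (intro card_le_gp_number finite_verts_P)
  moreover have "n - m + 1 \<le> card (pverts H - f ` (pverts G - {g}))" if "g \<in> pverts G" for g
  proof -
    have "card (f ` (pverts G - {g})) \<le> m - 1"
      using card_image_le[of "pverts G - {g}" f] that finite_G card_G by simp
    moreover have "card (pverts H - f ` (pverts G - {g})) = n - card (f ` (pverts G - {g}))"
      using f finite_G card_H by (subst card_Diff_subset) auto
    moreover have "0 < m"
      using that finite_G card_G card_gt_0_iff by blast
    ultimately show ?thesis using \<open>m \<le> n\<close> by linarith
  qed
  then have "m * (n - m + 1) \<le> card ?X"
    using sum_bounded_below[of "pverts G" "n - m + 1"] finite_G finite_H card_G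
    by (subst card_SigmaI) auto
  ultimately show ?thesis by linarith
qed

text \<open>As \<open>x \<noteq> f g'\<close>, no edge leads from \<open>(g, x)\<close> into the
  copy of \<open>g'\<close>. A detour of length 2 through a third copy would force
  \<open>f g = f g'\<close>, against injectivity. The conditional tail avoids repeating
  \<open>(g', f g)\<close> when \<open>h = f g\<close>.\<close>

lemma shortest_path_via_edge:
  assumes inj: "inj_on f (pverts G)"
    and g: "g \<in> pverts G" "g' \<in> pverts G" "g \<noteq> g'"
    and x: "x \<in> pverts H" "x \<noteq> f g'" and h: "h \<in> pverts H"
  shows "shortest_path ([(g, x), (g, f g'), (g', f g)] @ (if h = f g then [] else [(g', h)])) P"
    (is "shortest_path ?p P")
  unfolding shortest_path_def
proof (intro conjI allI impI)
  have "f g \<in> pverts H" "f g' \<in> pverts H"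
    using f g by auto
  then show "vpath ?p P"
    using g x h unfolding vpath_def vwalk_def by (auto simp: arc_P_iff verts_P)
next
  fix q assume "vpath q P \<and> hd q = hd ?p \<and> last q = last ?p"
  then have q: "vwalk q P" "hd q = (g, x)" "last q = (g', h)"
    by (auto simp: vpath_def split: if_splits)
  then obtain q1 where q1: "q = (g, x) # q1"
    by (metis list.collapse vwalk_def)
  with q g obtain v q2 where q2: "q1 = v # q2"
    by (cases q1) auto
  obtain k y where v: "v = (k, y)" by fastforce
  have "q2 \<noteq> []"
    using q g x unfolding q1 q2 v vwalk_def by (auto simp: arc_P_iff)
  then obtain w q3 where q3: "q2 = w # q3"
    by (meson neq_Nil_conv)
  \<comment> \<open>With length 2, the middle vertex can only be \<open>(g, f g')\<close>, so the
    walk ends at \<open>(g', f g)\<close>.\<close>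
  have "h = f g" if "q3 = []"
    using q g x that inj unfolding q1 q2 q3 v vwalk_def
    by (auto simp: arc_P_iff inj_on_eq_iff split: if_splits)
  then show "vwalk_length ?p \<le> vwalk_length q"
    unfolding q1 q2 q3 by (cases q3) auto
qed

lemma general_position_set_empty_copy:
  assumes inj: "inj_on f (pverts G)" and X: "general_position_set P X"
    and g: "g' \<in> pverts G" "g \<noteq> g'"
    and x: "(g, f g') \<in> X" "(g, x) \<in> X" "x \<noteq> f g'"
  shows "(g', h) \<notin> X"
proof
  assume h: "(g', h) \<in> X"
  have sub: "X \<subseteq> pverts G \<times> pverts H"
    using X verts_P unfolding general_position_set_def by simp
  let ?p = "[(g, x), (g, f g'), (g', f g)] @ (if h = f g then [] else [(g', h)])"
  have "shortest_path ?p P"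
    using sub g x h by (intro shortest_path_via_edge[OF inj]) auto
  moreover have "{(g, x), (g, f g'), (g', h)} \<subseteq> set ?p \<inter> X"
    using x h by auto
  ultimately have "card {(g, x), (g, f g'), (g', h)} \<le> 2"
    using X general_position_setD by blast
  with g x show False by simp
qed

lemma gp_number_le_of_inj:
  assumes m: "2 \<le> m" "2 * m - 2 \<le> n" and inj: "inj_on f (pverts G)"
  shows "gp_number P \<le> m * (n - m + 1)"
proof (rule gp_number_le[OF finite_verts_P])
  fix X assume X: "general_position_set P X"
  define S where "S g = {h. (g, h) \<in> X}" for g
  define E where "E = {g \<in> pverts G. S g = {}}"
  define k where "k = card E"
  have sub: "X \<subseteq> pverts G \<times> pverts H"
    using X verts_P unfolding general_position_set_def by simp
  then have S_sub: "S g \<subseteq> pverts H" for g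
    by (auto simp: S_def)
  have k_le: "k \<le> m"
    unfolding k_def E_def using card_mono[of "pverts G"] finite_G card_G by auto
  have card_S: "card (S g) \<le> n - m + 1 + k" if g: "g \<in> pverts G" for g
  proof (cases "card (S g) \<le> 1")
    case False
    \<comment> \<open>Since \<open>S g\<close> has a second element, each connecting vertex of this
      copy that lies in \<open>X\<close> leads to an empty copy.\<close>
    have "S g \<inter> f ` (pverts G - {g}) \<subseteq> f ` E"
    proof
      fix y assume "y \<in> S g \<inter> f ` (pverts G - {g})"
      then obtain g' where g': "y = f g'" "f g' \<in> S g" "g' \<in> pverts G" "g' \<noteq> g"
        by blast
      have "\<not> S g \<subseteq> {f g'}"
        using False card_mono[of "{f g'}" "S g"] by auto
      then obtain x where "x \<in> S g" "x \<noteq> f g'"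
        by blast
      then have "S g' = {}"
        using general_position_set_empty_copy[OF inj X, of g' g x] g' by (auto simp: S_def)
      with g' show "y \<in> f ` E"
        by (auto simp: E_def)
    qed
    then have "S g \<subseteq> (pverts H - f ` (pverts G - {g})) \<union> f ` E"
      using S_sub by blast
    then have "card (S g) \<le> card ((pverts H - f ` (pverts G - {g})) \<union> f ` E)"
      using finite_H finite_G by (intro card_mono) (auto simp: E_def)
    also have "\<dots> \<le> card (pverts H - f ` (pverts G - {g})) + card (f ` E)"
      by (rule card_Un_le)
    also have "card (f ` E) \<le> k"
      unfolding k_def using finite_G by (intro card_image_le) (simp add: E_def)
    also have "card (pverts H - f ` (pverts G - {g})) = n - card (f ` (pverts G - {g}))"
      using f finite_G card_H by (subst card_Diff_subset) auto
    \<comment> \<open>Injectivity gives equality here, hence \<open>n - (m - 1)\<close>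
      non-connecting vertices in each copy.\<close>
    also have "card (f ` (pverts G - {g})) = m - 1"
      using inj g finite_G card_G by (subst card_image) (auto intro: inj_on_subset)
    finally show ?thesis using m by linarith
  qed (use m in linarith)
  have X_eq: "X = Sigma (pverts G - E) S"
    using sub by (auto simp: S_def E_def)
  have "card X = (\<Sum>g \<in> pverts G - E. card (S g))"
    unfolding X_eq using finite_G finite_H S_sub
    by (intro card_SigmaI) (auto intro: finite_subset)
  also have "\<dots> \<le> card (pverts G - E) * (n - m + 1 + k)"
    using sum_bounded_above[of "pverts G - E" "\<lambda>g. card (S g)" "n - m + 1 + k"] card_S by simp
  also have "card (pverts G - E) = m - k"
    unfolding k_def using finite_G card_G by (subst card_Diff_subset) (auto simp: E_def)
  also have "(m - k) * (n - m + 1 + k) \<le> m * (n - m + 1)"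
  proof -
    obtain d where d: "m = d + k"
      using k_le by (metis add.commute le_Suc_ex)
    define c where "c = n - m + 1"
    have "d * k \<le> c * k"
    proof (cases "k = 0")
      case False
      \<comment> \<open>For \<open>k \<ge> 1\<close>,
        \<open>d \<le> m - 1 \<le> n - m + 1 = c\<close> by \<open>2 * m - 2 \<le> n\<close>. The
        case \<open>k = 0\<close> is separate because \<open>d = m\<close> can then exceed
        \<open>c\<close>.\<close>
      then have "d \<le> c" using m d unfolding c_def by linarith
      then show ?thesis by (rule mult_le_mono1)
    qed simp
    then have "d * (c + k) \<le> (d + k) * c"
      by (simp add: algebra_simps)
    then show ?thesis using d by (simp add: c_def)
  qed
  finally show "card X \<le> m * (n - m + 1)" .
qed

end

theorem theorem5p3:
  fixes m n :: nat
    and G :: "'a pair_pre_digraph" and H :: "'b pair_pre_digraph"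
  assumes "2 \<le> m" and "2 * m - 2 \<le> n"
    and "complete_digraph m (with_proj G)"
    and "complete_digraph n (with_proj H)"
  shows "lower_sierpinski_gp G H = m * (n - m + 1)"
proof -
  let ?gp = "\<lambda>f. gp_number (with_proj (sierpinski_product G H f))"
  let ?F = "pverts G \<rightarrow>\<^sub>E pverts H"
  have sierp: "complete_sierpinski G H m n f" if "f \<in> ?F" for f
    using assms that by unfold_locales auto
  have fin: "finite (pverts G)" "card (pverts G) = m" "finite (pverts H)" "card (pverts H) = n"
    using assms by (auto simp: complete_digraph_pair_def)
  have mn: "m \<le> n"
    using assms(1,2) by linarith
  \<comment> \<open>Any injection attains the minimum; restricting it to \<open>pverts G\<close>
    makes it extensional.\<close>
  then obtain f0 where f0: "f0 ` pverts G \<subseteq> pverts H" "inj_on f0 (pverts G)"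
    using fin by (metis card_le_inj)
  define f where "f = restrict f0 (pverts G)"
  have f: "f \<in> ?F" "inj_on f (pverts G)"
    using f0 by (auto simp: f_def inj_on_def)
  have lower: "m * (n - m + 1) \<le> ?gp g" if "g \<in> ?F" for g
    using sierp[OF that] mn by (rule complete_sierpinski.gp_number_ge)
  have "?gp f \<le> m * (n - m + 1)"
    using sierp[OF f(1)] assms(1,2) f(2) by (rule complete_sierpinski.gp_number_le_of_inj)
  with lower[OF f(1)] have eq: "m * (n - m + 1) = ?gp f"
    by linarith
  have "finite (?gp ` ?F)"
    using fin by (intro finite_imageI finite_PiE) auto
  moreover have "{?gp g | g. g \<in> ?F} = ?gp ` ?F"
    by blast
  ultimately show ?thesis
    unfolding lower_sierpinski_gp_def using f(1) lower eq by (intro Min_eqI) auto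
qed

end
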